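(* Let $n$ be a positive integer. Suppose we are given $n^2+n+1$ monochromatic complete graphs, each on $n+1$ vertices, each one colored in a color different from the color used for every other one. Then these $n^2+n+1$ complete graphs can be tightly packed in a totally disconnected graph on $n^2+n+1$ vertices if and only if a projective plane of order $n$ exists.
   Context: A graph is monochromatic if all its edges have the same color. A totally disconnected graph is a graph in which no two vertices are joined by an edge. Tightly packing the given complete graphs in a totally disconnected graph on a set $V$ of $n^2+n+1$ vertices means placing each of them on an $(n+1)$-element subset of $V$ (joining all pairs of vertices of that subset by edges of its color) so that every pair of distinct vertices of $V$ is joined by an edge of exactly one of the placed complete graphs; that is, the placed complete graphs are pairwise edge-disjoint and together form the complete graph on $V$. A (finite) projective plane of order $n$ is a collection of $n^2+n+1$ points and $n^2+n+1$ lines such that: (i) every line contains $n+1$ points; (ii) every point lies on $n+1$ lines; (iii) any two distinct lines intersect in exactly one point; (iv) any two distinct points lie on exactly one line. *)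

theory Defs
  imports "Graph_Theory.Graph_Theory"
begin

text \<open>
  Undirected graphs are the symmetric loop-free digraphs without parallel arcs of the
  locale \<open>graph\<close>; an undirected edge is a pair of opposite arcs.  An edge colouring is a function
  on arcs.
\<close>

definition monochromatic :: "('v, 'e) pre_digraph \<Rightarrow> ('e \<Rightarrow> 'c) \<Rightarrow> bool" where
  "monochromatic G colour \<longleftrightarrow> (\<exists>c. \<forall>e \<in> arcs G. colour e = c)"

definition totally_disconnected :: "('a, 'e) pre_digraph \<Rightarrow> bool" where
  "totally_disconnected T \<longleftrightarrow>
     graph T \<and> (\<forall>u \<in> verts T. \<forall>v \<in> verts T. \<not> u \<rightarrow>\<^bsub>T\<^esub> v)"

text \<open>
  The copy of \<open>G\<close> obtained by putting each vertex \<open>v\<close> at position \<open>f v\<close>.  The arcs keep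
  their identity, so a colouring of \<open>G\<close> is also a colouring of the copy.
\<close>

definition placed :: "('v \<Rightarrow> 'a) \<Rightarrow> ('v, 'e) pre_digraph \<Rightarrow> ('a, 'e) pre_digraph" where
  "placed f G = \<lparr> verts = f ` verts G, arcs = arcs G,
     tail = (\<lambda>e. f (tail G e)), head = (\<lambda>e. f (head G e)) \<rparr>"

definition tightly_packable ::
    "'i set \<Rightarrow> ('i \<Rightarrow> ('v, 'e) pre_digraph) \<Rightarrow> ('a, 'd) pre_digraph \<Rightarrow> bool" where
  "tightly_packable I G T \<longleftrightarrow>
     (\<exists>f. (\<forall>i \<in> I. inj_on (f i) (verts (G i)) \<and> verts (placed (f i) (G i)) \<subseteq> verts T) \<and>
          (\<forall>u \<in> verts T. \<forall>v \<in> verts T. u \<noteq> v \<longrightarrow>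
             (\<exists>!i. i \<in> I \<and> u \<rightarrow>\<^bsub>placed (f i) (G i)\<^esub> v)))"

definition projective_plane :: "nat \<Rightarrow> 'p set \<Rightarrow> 'p set set \<Rightarrow> bool" where
  "projective_plane n P L \<longleftrightarrow>
     finite P \<and> card P = n\<^sup>2 + n + 1 \<and>
     finite L \<and> card L = n\<^sup>2 + n + 1 \<and> (\<forall>l \<in> L. l \<subseteq> P) \<and>
     (\<forall>l \<in> L. card l = n + 1) \<and>
     (\<forall>p \<in> P. card {l \<in> L. p \<in> l} = n + 1) \<and>
     (\<forall>l \<in> L. \<forall>m \<in> L. l \<noteq> m \<longrightarrow> (\<exists>!p. p \<in> l \<inter> m)) \<and>
     (\<forall>p \<in> P. \<forall>q \<in> P. p \<noteq> q \<longrightarrow> (\<exists>!l. l \<in> L \<and> p \<in> l \<and> q \<in> l))"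

text \<open>
  Existence cannot quantify over the type of the points.  Natural numbers suffice, as the
  lemma \<open>projective_plane_existsI\<close> below shows.
\<close>

definition projective_plane_exists :: "nat \<Rightarrow> bool" where
  "projective_plane_exists n \<longleftrightarrow>
     (\<exists>(P :: nat set) L. projective_plane n P L)"

lemma projective_plane_image:
  assumes pp: "projective_plane n P L" and inj: "inj_on f P"
  shows "projective_plane n (f ` P) ((`) f ` L)"
proof -
  have fin: "finite P" "finite L"
    and cards: "card P = n\<^sup>2 + n + 1" "card L = n\<^sup>2 + n + 1"
    and subs: "\<forall>l \<in> L. l \<subseteq> P"
    and line_card: "\<forall>l \<in> L. card l = n + 1"
    and star_card: "\<forall>p \<in> P. card {l \<in> L. p \<in> l} = n + 1"
    and meet: "\<forall>l \<in> L. \<forall>m \<in> L. l \<noteq> m \<longrightarrow> (\<exists>!p. p \<in> l \<inter> m)"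
    and join: "\<forall>p \<in> P. \<forall>q \<in> P. p \<noteq> q \<longrightarrow> (\<exists>!l. l \<in> L \<and> p \<in> l \<and> q \<in> l)"
    using pp unfolding projective_plane_def by - (elim conjE, assumption)+
  have sub: "l \<subseteq> P" if "l \<in> L" for l
    using subs that by (rule bspec)
  have injL: "inj_on ((`) f) L"
    by (rule inj_on_subset[OF inj_on_image_Pow[OF inj]]) (use sub in blast)
  have mem: "f p \<in> f ` l \<longleftrightarrow> p \<in> l" if "p \<in> P" "l \<in> L" for p l
    using inj_on_image_mem_iff[OF inj that(1) sub[OF that(2)]] .
  have star: "{l \<in> (`) f ` L. f p \<in> l} = (`) f ` {l \<in> L. p \<in> l}" if "p \<in> P" for p
    using mem[OF that] by auto
  have lines_meet: "\<exists>!p. p \<in> f ` l \<inter> f ` m"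
    if lm: "l \<in> L" "m \<in> L" "f ` l \<noteq> f ` m" for l m
  proof -
    from lm have "l \<noteq> m" by blast
    with meet lm(1,2) have "\<exists>!p. p \<in> l \<inter> m"
      by (simp del: Int_iff)
    then obtain p where "p \<in> l \<inter> m" and "\<forall>q. q \<in> l \<inter> m \<longrightarrow> q = p"
      by metis
    then have "l \<inter> m = {p}"
      by blast
    then have "f ` l \<inter> f ` m = {f p}"
      using inj_on_image_Int[OF inj sub[OF lm(1)] sub[OF lm(2)]] by simp
    then show ?thesis by simp
  qed
  have points_join: "\<exists>!l. l \<in> (`) f ` L \<and> f p \<in> l \<and> f q \<in> l"
    if pq: "p \<in> P" "q \<in> P" "f p \<noteq> f q" for p q
  proof -
    from pq have "p \<noteq> q" by blast
    with join pq(1,2) have "\<exists>!l. l \<in> L \<and> p \<in> l \<and> q \<in> l"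
      by simp
    then obtain l where l: "l \<in> L" "p \<in> l" "q \<in> l"
      and uniq: "\<And>m. m \<in> L \<Longrightarrow> p \<in> m \<Longrightarrow> q \<in> m \<Longrightarrow> m = l"
      by metis
    show ?thesis
    proof (rule ex1I[of _ "f ` l"])
      show "f ` l \<in> (`) f ` L \<and> f p \<in> f ` l \<and> f q \<in> f ` l"
        using l by blast
    next
      fix k assume k: "k \<in> (`) f ` L \<and> f p \<in> k \<and> f q \<in> k"
      then obtain m where m: "m \<in> L" "k = f ` m"
        by blast
      with k have "p \<in> m" "q \<in> m"
        using mem pq(1,2) by simp_all
      with m uniq show "k = f ` l"
        by simp
    qed
  qed
  show ?thesis
    unfolding projective_plane_def
  proof (intro conjI)
    show "finite (f ` P)" "finite ((`) f ` L)"
      using fin by simp_all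
    show "card (f ` P) = n\<^sup>2 + n + 1"
      using cards card_image[OF inj] by simp
    show "card ((`) f ` L) = n\<^sup>2 + n + 1"
      using cards card_image[OF injL] by simp
    show "\<forall>l \<in> (`) f ` L. l \<subseteq> f ` P"
      using sub by blast
    show "\<forall>l \<in> (`) f ` L. card l = n + 1"
    proof
      fix k assume "k \<in> (`) f ` L"
      then obtain l where l: "l \<in> L" "k = f ` l"
        by blast
      have "card (f ` l) = card l"
        by (rule card_image[OF inj_on_subset[OF inj sub[OF l(1)]]])
      then show "card k = n + 1"
        using line_card l by simp
    qed
    show "\<forall>p \<in> f ` P. card {l \<in> (`) f ` L. p \<in> l} = n + 1"
    proof
      fix r assume "r \<in> f ` P"
      then obtain p where p: "p \<in> P" "r = f p"
        by blast
      have "inj_on ((`) f) {l \<in> L. p \<in> l}"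
        by (rule inj_on_subset[OF injL]) blast
      then have "card {l \<in> (`) f ` L. f p \<in> l} = card {l \<in> L. p \<in> l}"
        unfolding star[OF p(1)] by (rule card_image)
      then show "card {l \<in> (`) f ` L. r \<in> l} = n + 1"
        using star_card p by simp
    qed
    show "\<forall>l \<in> (`) f ` L. \<forall>m \<in> (`) f ` L. l \<noteq> m \<longrightarrow> (\<exists>!p. p \<in> l \<inter> m)"
    proof (intro ballI impI)
      fix k k' assume "k \<in> (`) f ` L" "k' \<in> (`) f ` L" "k \<noteq> k'"
      then obtain l m where "l \<in> L" "m \<in> L" "k = f ` l" "k' = f ` m"
        by blast
      with \<open>k \<noteq> k'\<close> show "\<exists>!p. p \<in> k \<inter> k'"
        using lines_meet[of l m] by simp
    qed
    show "\<forall>p \<in> f ` P. \<forall>q \<in> f ` P. p \<noteq> q \<longrightarrow> (\<exists>!l. l \<in> (`) f ` L \<and> p \<in> l \<and> q \<in> l)"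
    proof (intro ballI impI)
      fix r s assume "r \<in> f ` P" "s \<in> f ` P" "r \<noteq> s"
      then obtain p q where "p \<in> P" "q \<in> P" "r = f p" "s = f q"
        by blast
      with \<open>r \<noteq> s\<close> show "\<exists>!l. l \<in> (`) f ` L \<and> r \<in> l \<and> s \<in> l"
        using points_join[of p q] by simp
    qed
  qed
qed

lemma projective_plane_existsI:
  fixes P :: "'p set"
  assumes "projective_plane n P L"
  shows "projective_plane_exists n"
proof -
  have "finite P"
    using assms unfolding projective_plane_def by (elim conjE)
  then obtain f :: "'p \<Rightarrow> nat" where f: "inj_on f P"
    using finite_imp_inj_to_nat_seg[of P] by auto
  from projective_plane_image[OF assms f] show ?thesis
    unfolding projective_plane_exists_def by (intro exI)
qed

end

theory Submission
  imports Defs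
begin

text \<open>
  A copy of a complete graph is determined, as far as adjacency is concerned, by its vertex set:
  two distinct points are adjacent in the copy exactly when both lie in that set.  A tight packing
  is therefore the same thing as an indexed family of \<open>n\<^sup>2 + n + 1\<close> subsets of size \<open>n + 1\<close>
  of a set of \<open>n\<^sup>2 + n + 1\<close> points, such that any two distinct points lie in exactly one member.
  As the members have at least two points, no subset occurs twice, so the family may be replaced
  by the set of its members, the blocks (\<open>tightly_packable_iff_blocks\<close>).

  Such a system of subsets is already a projective plane (\<open>projective_plane_iff_blocks\<close>).  The
  blocks through a point \<open>p\<close> partition the other \<open>n (n + 1)\<close> points into parts of size \<open>n\<close>, so
  there are \<open>n + 1\<close> of them.  If \<open>l\<close> and \<open>m\<close> are distinct blocks, choose \<open>q\<close> on \<open>m\<close> and not on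
  \<open>l\<close>.  Joining \<open>q\<close> to the \<open>n + 1\<close> points of \<open>l\<close> gives \<open>n + 1\<close> different blocks through \<open>q\<close>,
  hence all of them; thus \<open>m\<close> is one of them and meets \<open>l\<close>.
  Finally, a projective plane can be moved along a bijection to any point set of the right size,
  in particular to the vertices of the totally disconnected graph.
\<close>

section \<open>Block systems with the parameters of a projective plane\<close>

text \<open>
  \<open>L\<close> is a set of blocks of size \<open>n + 1\<close> in \<open>P\<close>, and any two distinct points of \<open>P\<close> lie in exactly
  one block.  The numbers of points and of blocks are left free.
\<close>

definition pairwise_blocks :: "nat \<Rightarrow> 'p set \<Rightarrow> 'p set set \<Rightarrow> bool" where
  "pairwise_blocks n P L \<longleftrightarrow>
     (\<forall>l \<in> L. l \<subseteq> P \<and> card l = n + 1) \<and>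
     (\<forall>p \<in> P. \<forall>q \<in> P. p \<noteq> q \<longrightarrow> (\<exists>!l. l \<in> L \<and> p \<in> l \<and> q \<in> l))"

lemma pairwise_blocks_finite:
  assumes "pairwise_blocks n P L" "finite P"
  shows "finite L"
proof (rule finite_subset)
  show "L \<subseteq> Pow P"
    using assms(1) unfolding pairwise_blocks_def by blast
  show "finite (Pow P)"
    using assms(2) by simp
qed

lemma pairwise_blocks_join_ex:
  assumes "pairwise_blocks n P L" "p \<in> P" "q \<in> P" "p \<noteq> q"
  obtains l where "l \<in> L" "p \<in> l" "q \<in> l"
proof -
  have "\<exists>!l. l \<in> L \<and> p \<in> l \<and> q \<in> l"
    using assms unfolding pairwise_blocks_def by simp
  then show ?thesis
    using that by (elim ex1E conjE)
qed

lemma pairwise_blocks_join_unique: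
  assumes "pairwise_blocks n P L" "l \<in> L" "m \<in> L" "p \<noteq> q"
    and "p \<in> l" "q \<in> l" "p \<in> m" "q \<in> m"
  shows "l = m"
proof -
  have "p \<in> P" "q \<in> P"
    using assms unfolding pairwise_blocks_def by blast+
  then have "\<exists>!l. l \<in> L \<and> p \<in> l \<and> q \<in> l"
    using assms(1,4) unfolding pairwise_blocks_def by blast
  then show ?thesis
    using assms(2,3,5-8) by blast
qed

lemma pairwise_blocks_point_degree:
  assumes blocks: "pairwise_blocks n P L" and "finite P" and "card P = n\<^sup>2 + n + 1"
    and "n > 0" and "p \<in> P"
  shows "card {l \<in> L. p \<in> l} = n + 1"
proof -
  let ?S = "{l \<in> L. p \<in> l}"
  have fin: "finite l" if "l \<in> L" for l
    using that blocks finite_subset[OF _ \<open>finite P\<close>] unfolding pairwise_blocks_def by simp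
  have "P - {p} = (\<Union>l \<in> ?S. l - {p})"
  proof (intro equalityI subsetI)
    fix q assume "q \<in> P - {p}"
    then obtain l where "l \<in> L" "p \<in> l" "q \<in> l"
      using pairwise_blocks_join_ex[OF blocks \<open>p \<in> P\<close>, of q] by blast
    with \<open>q \<in> P - {p}\<close> show "q \<in> (\<Union>l \<in> ?S. l - {p})"
      by blast
  next
    fix q assume "q \<in> (\<Union>l \<in> ?S. l - {p})"
    then show "q \<in> P - {p}"
      using blocks unfolding pairwise_blocks_def by blast
  qed
  then have "card (P - {p}) = card (\<Union>l \<in> ?S. l - {p})"
    by (rule arg_cong)
  also have "\<dots> = (\<Sum>l \<in> ?S. card (l - {p}))"
  proof (rule card_UN_disjoint)
    show "finite ?S"
      using pairwise_blocks_finite[OF blocks \<open>finite P\<close>] by simp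
    show "\<forall>l \<in> ?S. finite (l - {p})"
      using fin by simp
    show "\<forall>l \<in> ?S. \<forall>m \<in> ?S. l \<noteq> m \<longrightarrow> (l - {p}) \<inter> (m - {p}) = {}"
      using pairwise_blocks_join_unique[OF blocks] by blast
  qed
  also have "\<dots> = (\<Sum>l \<in> ?S. n)"
    using blocks fin unfolding pairwise_blocks_def by (intro sum.cong) auto
  finally have "n * card ?S = n * (n + 1)"
    using assms(3,5) by (simp add: power2_eq_square algebra_simps)
  then show ?thesis
    using \<open>n > 0\<close> by (metis mult_cancel1 less_irrefl)
qed

lemma pairwise_blocks_meet:
  assumes blocks: "pairwise_blocks n P L" and "finite P" and "card P = n\<^sup>2 + n + 1"
    and "n > 0" and l: "l \<in> L" and m: "m \<in> L" and "l \<noteq> m"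
  shows "\<exists>!p. p \<in> l \<inter> m"
proof -
  have sub: "l \<subseteq> P" "m \<subseteq> P" and cards: "card l = n + 1" "card m = n + 1"
    using blocks l m unfolding pairwise_blocks_def by auto
  have "finite l"
    using sub(1) \<open>finite P\<close> by (rule finite_subset)
  then have "\<not> m \<subseteq> l"
    using cards \<open>l \<noteq> m\<close> card_subset_eq[of l m] by auto
  then obtain q where q: "q \<in> m" "q \<notin> l"
    by blast
  then have "q \<in> P"
    using sub by blast
  let ?S = "{k \<in> L. q \<in> k}"
  have "\<forall>p \<in> l. \<exists>k. k \<in> L \<and> q \<in> k \<and> p \<in> k"
  proof
    fix p assume "p \<in> l"
    then have "p \<in> P" "q \<noteq> p"
      using sub q by auto
    then show "\<exists>k. k \<in> L \<and> q \<in> k \<and> p \<in> k"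
      using pairwise_blocks_join_ex[OF blocks \<open>q \<in> P\<close>] by blast
  qed
  then obtain join where join: "\<And>p. p \<in> l \<Longrightarrow> join p \<in> L \<and> q \<in> join p \<and> p \<in> join p"
    by metis
  have "inj_on join l"
  proof (rule inj_onI, rule ccontr)
    fix p p' assume p: "p \<in> l" "p' \<in> l" "join p = join p'" "p \<noteq> p'"
    \<comment> \<open>Otherwise \<open>join p\<close> has two points in common with \<open>l\<close>, hence is \<open>l\<close>, and \<open>q\<close> lies on \<open>l\<close>.\<close>
    then have "join p = l"
      using join[of p] join[of p'] pairwise_blocks_join_unique[OF blocks _ l, of "join p" p p']
      by simp
    then show False
      using join[OF p(1)] q(2) by simp
  qed
  then have "card (join ` l) = card ?S"
    using cards pairwise_blocks_point_degree[OF assms(1-4) \<open>q \<in> P\<close>] by (simp add: card_image)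
  moreover have "finite ?S"
    using pairwise_blocks_finite[OF blocks \<open>finite P\<close>] by simp
  moreover have "join ` l \<subseteq> ?S"
    using join by blast
  ultimately have "join ` l = ?S"
    by (intro card_subset_eq)
  then obtain p where "p \<in> l" "m = join p"
    using m q(1) by blast
  then have "p \<in> l \<inter> m"
    using join by blast
  moreover have "p' = p" if "p' \<in> l \<inter> m" for p'
    using pairwise_blocks_join_unique[OF blocks l m, of p' p] that \<open>p \<in> l \<inter> m\<close> \<open>l \<noteq> m\<close>
    by blast
  ultimately show ?thesis
    by blast
qed

lemma projective_plane_iff_blocks:
  assumes "n > 0"
  shows "projective_plane n P L \<longleftrightarrow>
    finite P \<and> card P = n\<^sup>2 + n + 1 \<and> card L = n\<^sup>2 + n + 1 \<and> pairwise_blocks n P L"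
    (is "?plane \<longleftrightarrow> ?blocks")
proof
  show ?plane if ?blocks
  proof -
    have P: "finite P" "card P = n\<^sup>2 + n + 1" and L: "card L = n\<^sup>2 + n + 1"
      and blocks: "pairwise_blocks n P L"
      using that by auto
    have "\<forall>l \<in> L. l \<subseteq> P" "\<forall>l \<in> L. card l = n + 1"
      "\<forall>p \<in> P. \<forall>q \<in> P. p \<noteq> q \<longrightarrow> (\<exists>!l. l \<in> L \<and> p \<in> l \<and> q \<in> l)"
      using blocks unfolding pairwise_blocks_def by simp_all
    moreover have "\<forall>p \<in> P. card {l \<in> L. p \<in> l} = n + 1"
      using pairwise_blocks_point_degree[OF blocks P \<open>n > 0\<close>] by (rule ballI)
    moreover have "\<forall>l \<in> L. \<forall>m \<in> L. l \<noteq> m \<longrightarrow> (\<exists>!p. p \<in> l \<inter> m)"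
      using pairwise_blocks_meet[OF blocks P \<open>n > 0\<close>] by (intro ballI impI)
    ultimately show ?thesis
      unfolding projective_plane_def
      using P L pairwise_blocks_finite[OF blocks P(1)] by (intro conjI)
  qed
  show ?blocks if ?plane
  proof -
    have "\<forall>l \<in> L. l \<subseteq> P \<and> card l = n + 1"
      using that unfolding projective_plane_def ball_conj_distrib by (elim conjE, intro conjI)
    then show ?thesis
      using that unfolding projective_plane_def pairwise_blocks_def by (elim conjE, intro conjI)
  qed
qed

section \<open>Packings of complete graphs as block systems\<close>

lemma dominates_placed_complete:
  assumes "K\<^bsub>k\<^esub> H" and "inj_on f (verts H)"
  shows "u \<rightarrow>\<^bsub>placed f H\<^esub> v \<longleftrightarrow> u \<in> f ` verts H \<and> v \<in> f ` verts H \<and> u \<noteq> v"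
proof -
  have "arcs_ends (placed f H) = map_prod f f ` arcs_ends H"
    unfolding arcs_ends_def arc_to_ends_def placed_def by (simp add: image_image)
  also have "\<dots> = map_prod f f ` {(x, y). (x, y) \<in> verts H \<times> verts H \<and> x \<noteq> y}"
    using assms(1) unfolding complete_digraph_def by simp
  finally show ?thesis
    using inj_onD[OF assms(2)] by (auto simp: image_iff)
qed

lemma tightly_packable_iff_blocks:
  assumes "n > 0" and "card I = n\<^sup>2 + n + 1"
    and complete: "\<And>i. i \<in> I \<Longrightarrow> K\<^bsub>n + 1\<^esub> (G i)"
  shows "tightly_packable I G T \<longleftrightarrow>
    (\<exists>L. card L = n\<^sup>2 + n + 1 \<and> pairwise_blocks n (verts T) L)"
proof
  assume "tightly_packable I G T"
  then obtain f
    where place: "\<forall>i \<in> I. inj_on (f i) (verts (G i)) \<and> verts (placed (f i) (G i)) \<subseteq> verts T"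
      and cover: "\<forall>u \<in> verts T. \<forall>v \<in> verts T. u \<noteq> v \<longrightarrow>
        (\<exists>!i. i \<in> I \<and> u \<rightarrow>\<^bsub>placed (f i) (G i)\<^esub> v)"
    unfolding tightly_packable_def by (elim exE conjE)
  have inj: "inj_on (f i) (verts (G i))" and sub: "f i ` verts (G i) \<subseteq> verts T" if "i \<in> I" for i
    using bspec[OF place that] by (simp_all add: placed_def)
  have pack: "\<exists>!i. i \<in> I \<and> u \<rightarrow>\<^bsub>placed (f i) (G i)\<^esub> v"
    if "u \<in> verts T" "v \<in> verts T" "u \<noteq> v" for u v
    using bspec[OF bspec[OF cover that(1)] that(2)] that(3) by (rule mp)
  define B where "B i = f i ` verts (G i)" for i
  have dom: "u \<rightarrow>\<^bsub>placed (f i) (G i)\<^esub> v \<longleftrightarrow> u \<in> B i \<and> v \<in> B i \<and> u \<noteq> v"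
    if "i \<in> I" for i u v
    unfolding B_def using dominates_placed_complete[OF complete inj] that by blast
  have cardB: "card (B i) = n + 1" if "i \<in> I" for i
    using card_image[OF inj[OF that]] complete[OF that]
    unfolding B_def complete_digraph_def by simp
  have unique: "i = j"
    if "i \<in> I" "j \<in> I" "u \<noteq> v" "u \<in> B i" "v \<in> B i" "u \<in> B j" "v \<in> B j" for i j u v
  proof -
    have "u \<in> verts T" "v \<in> verts T"
      using sub that unfolding B_def by blast+
    with pack that show ?thesis
      using dom by metis
  qed
  have "inj_on B I"
  proof (rule inj_onI)
    fix i j assume ij: "i \<in> I" "j \<in> I" "B i = B j"
    \<comment> \<open>A block has \<open>n + 1 \<ge> 2\<close> points, and two points determine the index of their block.\<close>
    have "\<not> card (B i) \<le> 1"
      using cardB[OF ij(1)] \<open>n > 0\<close> by simp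
    then obtain u v where "u \<in> B i" "v \<in> B i" "u \<noteq> v"
      using card_le_Suc0_iff_eq[of "B i"] card.infinite[of "B i"] by fastforce
    then show "i = j"
      using unique ij by simp
  qed
  then have "card (B ` I) = n\<^sup>2 + n + 1"
    using assms(2) by (simp add: card_image)
  moreover have "pairwise_blocks n (verts T) (B ` I)"
    unfolding pairwise_blocks_def
  proof (intro conjI ballI impI)
    fix l assume "l \<in> B ` I"
    then show "l \<subseteq> verts T" "card l = n + 1"
      using sub cardB by (auto simp: B_def)
  next
    fix u v assume uv: "u \<in> verts T" "v \<in> verts T" "u \<noteq> v"
    then obtain i where "i \<in> I" "u \<in> B i" "v \<in> B i"
      using pack dom by metis
    with unique uv(3) show "\<exists>!l. l \<in> B ` I \<and> u \<in> l \<and> v \<in> l"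
      by blast
  qed
  ultimately show "\<exists>L. card L = n\<^sup>2 + n + 1 \<and> pairwise_blocks n (verts T) L"
    by blast
next
  assume "\<exists>L. card L = n\<^sup>2 + n + 1 \<and> pairwise_blocks n (verts T) L"
  then obtain L where L: "card L = n\<^sup>2 + n + 1" and blocks: "pairwise_blocks n (verts T) L"
    by blast
  have "finite I" "finite L"
    using assms(2) L by (auto intro: card_ge_0_finite)
  then obtain B where B: "bij_betw B I L"
    using assms(2) L finite_same_card_bij[of I L] by auto
  have BL: "B i \<in> L" if "i \<in> I" for i
    using B that by (rule bij_betw_apply)
  have "\<exists>h. bij_betw h (verts (G i)) (B i)" if "i \<in> I" for i
  proof (rule finite_same_card_bij)
    have "card (verts (G i)) = n + 1" "card (B i) = n + 1"
      using complete[OF that] BL[OF that] blocks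
      unfolding complete_digraph_def pairwise_blocks_def by auto
    then show "finite (verts (G i))" "finite (B i)" "card (verts (G i)) = card (B i)"
      by (auto intro: card_ge_0_finite)
  qed
  then obtain f where f: "\<And>i. i \<in> I \<Longrightarrow> bij_betw (f i) (verts (G i)) (B i)"
    by metis
  have dom: "u \<rightarrow>\<^bsub>placed (f i) (G i)\<^esub> v \<longleftrightarrow> u \<in> B i \<and> v \<in> B i \<and> u \<noteq> v"
    if "i \<in> I" for i u v
    using dominates_placed_complete[OF complete[OF that] bij_betw_imp_inj_on[OF f[OF that]]]
      bij_betw_imp_surj_on[OF f[OF that]] by simp
  show "tightly_packable I G T"
    unfolding tightly_packable_def
  proof (intro exI[of _ f] conjI ballI impI)
    fix i assume i: "i \<in> I"
    show "inj_on (f i) (verts (G i))"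
      using f[OF i] by (rule bij_betw_imp_inj_on)
    show "verts (placed (f i) (G i)) \<subseteq> verts T"
      using f[OF i] BL[OF i] blocks
      unfolding placed_def pairwise_blocks_def by (simp add: bij_betw_imp_surj_on)
  next
    fix u v assume uv: "u \<in> verts T" "v \<in> verts T" "u \<noteq> v"
    then obtain l where l: "l \<in> L" "u \<in> l" "v \<in> l"
      using pairwise_blocks_join_ex[OF blocks] by blast
    then obtain i where i: "i \<in> I" "l = B i"
      using B unfolding bij_betw_def by blast
    show "\<exists>!i. i \<in> I \<and> u \<rightarrow>\<^bsub>placed (f i) (G i)\<^esub> v"
    proof (rule ex1I[of _ i])
      show "i \<in> I \<and> u \<rightarrow>\<^bsub>placed (f i) (G i)\<^esub> v"
        using dom i l uv by simp
    next
      fix j assume j: "j \<in> I \<and> u \<rightarrow>\<^bsub>placed (f j) (G j)\<^esub> v"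
      then have "u \<in> B j" "v \<in> B j"
        using dom by blast+
      then have "B j = B i"
        using i j l uv(3) BL pairwise_blocks_join_unique[OF blocks, of "B j" "B i" u v] by blast
      then show "j = i"
        using B i j unfolding bij_betw_def inj_on_def by blast
    qed
  qed
qed

section \<open>Packings and projective planes\<close>

lemma projective_plane_exists_iff_on:
  assumes "finite P" and "card P = n\<^sup>2 + n + 1"
  shows "projective_plane_exists n \<longleftrightarrow> (\<exists>L. projective_plane n P L)"
proof
  assume "projective_plane_exists n"
  then obtain Q :: "nat set" and M where plane: "projective_plane n Q M"
    unfolding projective_plane_exists_def by blast
  then have "finite Q" "card Q = n\<^sup>2 + n + 1"
    unfolding projective_plane_def by - (elim conjE, assumption)+
  then obtain g where "bij_betw g Q P"
    using finite_same_card_bij[of Q P] assms by auto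
  then have "inj_on g Q" "g ` Q = P"
    unfolding bij_betw_def by auto
  then show "\<exists>L. projective_plane n P L"
    using projective_plane_image[OF plane, of g] by auto
next
  assume "\<exists>L. projective_plane n P L"
  then show "projective_plane_exists n"
    by (auto intro: projective_plane_existsI)
qed

theorem theorem2p1:
  fixes n :: nat
    and I :: "'i set"
    and G :: "'i \<Rightarrow> ('v, 'e) pre_digraph"
    and colour :: "'i \<Rightarrow> 'e \<Rightarrow> 'c"
    and T :: "('a, 'd) pre_digraph"
  assumes "n > 0"
    and "card I = n\<^sup>2 + n + 1"
    and "\<And>i. i \<in> I \<Longrightarrow> K\<^bsub>n + 1\<^esub> (G i)"
    and "\<And>i. i \<in> I \<Longrightarrow> monochromatic (G i) (colour i)"
    and "\<And>i j e e'. \<lbrakk>i \<in> I; j \<in> I; i \<noteq> j; e \<in> arcs (G i); e' \<in> arcs (G j)\<rbrakk>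
           \<Longrightarrow> colour i e \<noteq> colour j e'"
    and "totally_disconnected T"
    and "card (verts T) = n\<^sup>2 + n + 1"
  shows "tightly_packable I G T \<longleftrightarrow> projective_plane_exists n"
proof -
  have fin: "finite (verts T)"
    using assms(7) by (auto intro: card_ge_0_finite)
  have "tightly_packable I G T \<longleftrightarrow>
      (\<exists>L. card L = n\<^sup>2 + n + 1 \<and> pairwise_blocks n (verts T) L)"
    using assms(1-3) by (rule tightly_packable_iff_blocks)
  also have "\<dots> \<longleftrightarrow> (\<exists>L. projective_plane n (verts T) L)"
    unfolding projective_plane_iff_blocks[OF assms(1)] using fin assms(7) by blast
  also have "\<dots> \<longleftrightarrow> projective_plane_exists n"
    using projective_plane_exists_iff_on[OF fin assms(7)] by simp
  finally show ?thesis .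
qed

end
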